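(* Let $n_x,n_r$ be positive integers with $n_r<n_x$, let $S\in\mathbb{R}^{n_r\times n_x}$ have full row rank, let $q,\bar\tau_x,\bar\tau_\nu>0$, $\rho\ge0$ and $t_b,t_c\ge0$ be scalars. Consider the input-output augmented saddle-point system $G_{\rm aug}$ with uniform parameters $Q=qI_{n_x}$, $\mathcal{T}_x=\bar\tau_xI_{n_x}$, $\mathcal{T}_\nu=\bar\tau_\nu I_{n_r}$ and $W_b=I_{n_r}$, with state $(x,\nu)\in\mathbb{R}^{n_x}\times\mathbb{R}^{n_r}$, input $(\eta_c,\eta_b)\in\mathbb{R}^{n_x}\times\mathbb{R}^{n_r}$ and output $z\in\mathbb{R}^{n_x}$: $$\bar\tau_x\dot x=-(qI_{n_x}+\rho S^{\sf T}S)x-S^{\sf T}\nu-t_c\,\eta_c+\rho\,t_b\,S^{\sf T}\eta_b,\qquad \bar\tau_\nu\dot\nu=Sx-t_b\,\eta_b,\qquad z=q^{1/2}x$$ (so that $\|z(t)\|_2^2=q\|x(t)\|_2^2$). Then the squared $\mathcal{H}_2$ norm of this system is $$\|G_{\rm aug}\|_{\mathcal{H}_2}^2=\frac{t_c^2}{2\bar\tau_x}(n_x-n_r)+\left(\frac{t_b^2}{2\bar\tau_\nu}+\frac{t_c^2}{2\bar\tau_x}\right)\sum_{i=1}^{n_r}\frac{q}{q+\rho\sigma_i^2}+\frac{t_b^2}{2\bar\tau_x}\sum_{i=1}^{n_r}\frac{q\rho^2\sigma_i^2}{q+\rho\sigma_i^2},$$ where $\sigma_1,\dots,\sigma_{n_r}$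 are the non-zero singular values of $S$.
   Context: For an LTI system $\dot\xi=A\xi+B\eta$, $z=C\xi$ with $A$ Hurwitz, the $\mathcal{H}_2$ norm from $\eta$ to $z$ is defined by $\|G\|_{\mathcal{H}_2}^2=\frac{1}{2\pi}\int_{-\infty}^{\infty}\mathrm{Tr}\big(G(-j\omega)^{\sf T}G(j\omega)\big)\,d\omega$ with $G(j\omega)=C(j\omega I-A)^{-1}B$. Equivalently, $\|G\|_{\mathcal{H}_2}^2=\mathrm{Tr}(B^{\sf T}XB)$, where $X=X^{\sf T}\succeq 0$ is the unique solution of $A^{\sf T}X+XA+C^{\sf T}C=0$. The system models the saddle-point algorithm for the augmented Lagrangian $\frac12x^{\sf T}Qx+c^{\sf T}x+\nu^{\sf T}(Sx-W_bb)+\frac{\rho}{2}\|Sx-W_bb\|_2^2$, with disturbances $b\mapsto b+t_b\eta_b$, $c\mapsto c+t_c\eta_c$, in coordinates shifted to the equilibrium. Singular values are counted with multiplicity. *)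

theory Defs
  imports "HOL-Analysis.Analysis" "HOL-Computational_Algebra.Polynomial"
begin

definition complex_matrix :: "real^'n^'m \<Rightarrow> complex^'n^'m" where
  "complex_matrix = map_matrix complex_of_real"

definition hurwitz :: "real^'n^'n \<Rightarrow> bool" where
  "hurwitz A \<longleftrightarrow>
     (\<forall>l v. v \<noteq> 0 \<longrightarrow> complex_matrix A *v v = l *s v \<longrightarrow> Re l < 0)"

definition transfer_function ::
    "real^'n^'n \<Rightarrow> real^'m^'n \<Rightarrow> real^'n^'p \<Rightarrow> complex \<Rightarrow> complex^'m^'p" where
  "transfer_function A B C s =
     complex_matrix C ** matrix_inv (mat s - complex_matrix A) ** complex_matrix B"

text \<open>The integrand is the complex number \<open>Tr(G(-j\<omega>)\<^sup>T G(j\<omega>))\<close>, whose imaginary part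
  vanishes because the system matrices are real; \<open>Re\<close> is only the passage from
  \<open>complex\<close> to \<open>real\<close>. The value is meaningful when \<open>A\<close> is Hurwitz.\<close>

definition h2_norm :: "real^'n^'n \<Rightarrow> real^'m^'n \<Rightarrow> real^'n^'p \<Rightarrow> real" where
  "h2_norm A B C = sqrt (Re (1 / (2 * complex_of_real pi) *
     (LINT w|lborel.
        trace (transpose (transfer_function A B C (- (\<i> * complex_of_real w)))
               ** transfer_function A B C (\<i> * complex_of_real w)))))"

definition charpoly :: "'a::idom^'n^'n \<Rightarrow> 'a poly" where
  "charpoly M = det (mat (monom 1 1) - map_matrix (\<lambda>a. [:a:]) M)"

text \<open>Square roots of the eigenvalues of \<open>S\<^sup>T S\<close>, each with its multiplicity as a root of
  the characteristic polynomial.\<close>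

definition singular_values :: "real^'n^'m \<Rightarrow> real multiset" where
  "singular_values S = image_mset sqrt (proots (charpoly (transpose S ** S)))"

definition stack :: "'a^'n \<Rightarrow> 'a^'m \<Rightarrow> 'a^('n + 'm)" where
  "stack x y = (\<chi> i. case i of Inl k \<Rightarrow> x $ k | Inr k \<Rightarrow> y $ k)"

definition block_row :: "'a^'n^'p \<Rightarrow> 'a^'m^'p \<Rightarrow> 'a^('n + 'm)^'p" where
  "block_row M N = (\<chi> i. stack (M $ i) (N $ i))"

definition block_matrix ::
    "'a^'n^'p \<Rightarrow> 'a^'m^'p \<Rightarrow> 'a^'n^'q \<Rightarrow> 'a^'m^'q \<Rightarrow> 'a^('n + 'm)^('p + 'q)" where
  "block_matrix M11 M12 M21 M22 = stack (block_row M11 M12) (block_row M21 M22)"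

text \<open>State-space matrices of the augmented saddle-point system, with state \<open>stack x \<nu>\<close>
  and input \<open>stack \<eta>\<^sub>c \<eta>\<^sub>b\<close>; the lemma \<open>aug_dynamics\<close> below recovers the equations of motion.\<close>

definition aug_A :: "real \<Rightarrow> real \<Rightarrow> real \<Rightarrow> real \<Rightarrow> real^'x^'r \<Rightarrow> real^('x + 'r)^('x + 'r)" where
  "aug_A q tx tn \<rho> S = block_matrix
     ((- 1 / tx) *\<^sub>R (q *\<^sub>R mat 1 + \<rho> *\<^sub>R (transpose S ** S)))  ((- 1 / tx) *\<^sub>R transpose S)
     ((1 / tn) *\<^sub>R S)                                          0"

definition aug_B :: "real \<Rightarrow> real \<Rightarrow> real \<Rightarrow> real \<Rightarrow> real \<Rightarrow> real^'x^'r \<Rightarrow> real^('x + 'r)^('x + 'r)" where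
  "aug_B tx tn \<rho> tb tc S = block_matrix
     ((- tc / tx) *\<^sub>R mat 1)  ((\<rho> * tb / tx) *\<^sub>R transpose S)
     0                        ((- tb / tn) *\<^sub>R mat 1)"

definition aug_C :: "real \<Rightarrow> real^('x::finite + 'r::finite)^'x" where
  "aug_C q = block_row (sqrt q *\<^sub>R mat 1) 0"

lemma block_row_mult_stack:
  fixes M :: "real^'n^'p" and N :: "real^'m^'p"
  shows "block_row M N *v stack x y = M *v x + N *v y"
  by (simp add: vec_eq_iff block_row_def stack_def matrix_vector_mult_def
        UNIV_Plus_UNIV[symmetric] sum.Plus del: UNIV_Plus_UNIV)

lemma block_matrix_mult_stack:
  fixes M11 :: "real^'n^'p" and M12 :: "real^'m^'p" and M21 :: "real^'n^'q" and M22 :: "real^'m^'q"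
  shows "block_matrix M11 M12 M21 M22 *v stack x y
           = stack (M11 *v x + M12 *v y) (M21 *v x + M22 *v y)"
proof -
  have "(block_matrix M11 M12 M21 M22 *v stack x y) $ i
          = stack (block_row M11 M12 *v stack x y) (block_row M21 M22 *v stack x y) $ i" for i
    by (cases i) (simp_all add: block_matrix_def matrix_vector_mult_def stack_def)
  then show ?thesis
    by (simp add: vec_eq_iff block_row_mult_stack)
qed

lemma stack_add: "stack x y + stack x' y' = stack (x + x') (y + y')"
  by (simp add: vec_eq_iff stack_def split: sum.split)

lemma stack_eq_iff: "stack x y = stack x' y' \<longleftrightarrow> x = x' \<and> y = y'"
proof
  assume *: "stack x y = stack x' y'"
  have "x $ i = x' $ i" for i
    using arg_cong[OF *, of "\<lambda>v. v $ Inl i"] by (simp add: stack_def)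
  moreover have "y $ i = y' $ i" for i
    using arg_cong[OF *, of "\<lambda>v. v $ Inr i"] by (simp add: stack_def)
  ultimately show "x = x' \<and> y = y'"
    by (simp add: vec_eq_iff)
qed simp

lemma aug_dynamics:
  fixes S :: "real^'x^'r" and x dx ec :: "real^'x" and n dn eb :: "real^'r"
  assumes "tx > 0" "tn > 0"
  shows "stack dx dn = aug_A q tx tn \<rho> S *v stack x n + aug_B tx tn \<rho> tb tc S *v stack ec eb
     \<longleftrightarrow> tx *\<^sub>R dx = - ((q *\<^sub>R mat 1 + \<rho> *\<^sub>R (transpose S ** S)) *v x) - transpose S *v n
                    - tc *\<^sub>R ec + (\<rho> * tb) *\<^sub>R (transpose S *v eb)
       \<and> tn *\<^sub>R dn = S *v x - tb *\<^sub>R eb"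
proof -
  have scale: "u = v \<longleftrightarrow> c *\<^sub>R u = c *\<^sub>R v" if "c > 0" for c :: real and u v :: "real^'k"
    using that by simp
  have neg: "(- M) *v u = - (M *v u)" for M :: "real^'k^'l" and u
    by (simp add: vec_eq_iff matrix_vector_mult_def sum_negf)
  show ?thesis
    unfolding aug_A_def aug_B_def block_matrix_mult_stack stack_add stack_eq_iff
      scale[OF assms(1), of dx] scale[OF assms(2), of dn]
    using assms by (simp add: scaleR_matrix_vector_assoc[symmetric] neg
        matrix_vector_mult_add_rdistrib matrix_vector_mult_diff_rdistrib algebra_simps)
qed

lemma aug_output: "aug_C q *v stack x n = sqrt q *\<^sub>R x"
  by (simp add: aug_C_def block_row_mult_stack scaleR_matrix_vector_assoc[symmetric])

end

(* Eliminating nu from the Laplace-transformed dynamics leaves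
     (tx tn s^2 + tn s (q + rho S^T S) + S^T S) x = - tc tn s eta_c + tb (rho tn s + 1) S^T eta_b,
   so in an orthonormal eigenbasis of S^T S the trace of G(-jw)^T G(jw) is, for w ~= 0, a sum over
   the eigenvalues l of (alpha w^2 + beta) / |b2 (jw)^2 + b1 jw + b0|^2 with b2 = tx tn,
   b1 = tn (q + rho l) and b0 = l. The integrals of w^2 and 1 against this weight are
   pi / (b1 b2) and pi / (b1 b0). The eigenvalue 0 of S^T S, which contributes only
   tc^2 / (2 tx), has multiplicity n_x - n_r. Stability is an energy argument: the real part of the
   eigenvalue times the positive quantity tx |x|^2 + tn |nu|^2 equals - q |x|^2 - rho |S x|^2. *)
theory Submission
  imports Defs "HOL-Real_Asymp.Real_Asymp"
begin

section \<open>Diagonalization of real symmetric matrices\<close>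

text \<open>One point is a null set, hence the care about integrals off a point. An eigenvalue 0
  also makes b0 = 0, where the integral of 1 against the weight diverges. Its coefficient beta
  carries a factor l, which is 0 for such a mode; for l > 0 the same factor cancels the 1 / b0 of
  the integral. That is why the term with \<open>tb\<^sup>2 / (2 * tn)\<close> survives for every
  non-zero singular value, however small, and is absent for the zero ones. Singular values are given
  as roots of a characteristic polynomial with multiplicity. The polynomial is therefore the link
  between the orthonormal eigenbasis and the numbers \<sigma>, and the multiplicity of 0 follows by
  counting roots.\<close>

text \<open>A maximizer of the Rayleigh quotient on the unit sphere of \<open>V\<close> is an
  eigenvector: the residual \<open>f v - l *\<^sub>R v\<close> stays in \<open>V\<close> by
  invariance, and moving along it would increase the quotient unless it is 0.\<close>

lemma self_adjoint_eigenvector_in_subspace: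
  fixes f :: "'a::euclidean_space \<Rightarrow> 'a"
  assumes "linear f" and sym: "\<And>x y. f x \<bullet> y = x \<bullet> f y"
    and V: "subspace V" "f ` V \<subseteq> V" "V \<noteq> {0}"
  obtains v l where "v \<in> V" "norm v = 1" "f v = l *\<^sub>R v"
proof -
  let ?K = "V \<inter> sphere 0 1"
  obtain u where "u \<in> V" "u \<noteq> 0"
    using V subspace_0 by blast
  then have "u /\<^sub>R norm u \<in> ?K"
    using V(1) by (auto simp: subspace_scale)
  moreover have "compact ?K"
    by (intro closed_Int_compact closed_subspace V compact_sphere)
  moreover have "continuous_on ?K (\<lambda>v. v \<bullet> f v)"
    by (intro continuous_intros linear_continuous_on linear_conv_bounded_linear[THEN iffD1] \<open>linear f\<close>)
  ultimately obtain v where v: "v \<in> ?K" and max: "\<And>w. w \<in> ?K \<Longrightarrow> w \<bullet> f w \<le> v \<bullet> f v"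
    using continuous_attains_sup[of ?K "\<lambda>v. v \<bullet> f v"] by blast
  define l where "l = v \<bullet> f v"
  have le: "w \<bullet> f w \<le> l * (w \<bullet> w)" if "w \<in> V" for w
  proof (cases "w = 0")
    case True
    then show ?thesis using linear_0[OF \<open>linear f\<close>] by simp
  next
    case False
    have "(w /\<^sub>R norm w) \<bullet> f (w /\<^sub>R norm w) \<le> l"
      unfolding l_def using that False V(1) by (intro max) (auto simp: subspace_scale)
    then show ?thesis
      using False by (simp add: linear_cmul[OF \<open>linear f\<close>] field_simps power2_norm_eq_inner[symmetric]
          power2_eq_square)
  qed
  define w where "w = f v - l *\<^sub>R v"
  have "w \<in> V"
    using v V by (auto simp: w_def intro!: subspace_diff subspace_scale)
  have vv: "v \<bullet> v = 1"
    using v by (simp add: norm_eq_1)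
  define d where "d = l * (w \<bullet> w) - w \<bullet> f w"
  \<comment> \<open>Maximality at \<open>v\<close> applied to \<open>v + t *\<^sub>R w\<close>: the
    terms of order 0 cancel and those of order 1 leave twice the squared norm of
    \<open>w\<close>.\<close>
  have quad: "2 * t * (w \<bullet> w) \<le> t\<^sup>2 * d" for t
  proof -
    have "(v + t *\<^sub>R w) \<bullet> f (v + t *\<^sub>R w) \<le> l * ((v + t *\<^sub>R w) \<bullet> (v + t *\<^sub>R w))"
      using v V(1) \<open>w \<in> V\<close> by (intro le) (auto intro!: subspace_add subspace_scale)
    moreover have "w \<bullet> f v = w \<bullet> w + l * (w \<bullet> v)"
      by (subst (3) w_def) (simp add: inner_diff_right)
    moreover have "v \<bullet> f w = w \<bullet> w + l * (w \<bullet> v)"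
      using calculation(2) by (metis sym inner_commute)
    ultimately show ?thesis
      by (simp add: linear_add[OF \<open>linear f\<close>] linear_cmul[OF \<open>linear f\<close>] d_def inner_simps vv
          l_def[symmetric] inner_commute[of v w] power2_eq_square algebra_simps)
  qed
  have "w \<bullet> w = 0"
  proof (rule ccontr)
    assume "w \<bullet> w \<noteq> 0"
    then have pos: "w \<bullet> w > 0" using inner_ge_zero[of w] by linarith
    have "\<bar>d\<bar> + 1 > 0" by simp
    \<comment> \<open>With \<open>t = w \<bullet> w / (\<bar>d\<bar> + 1)\<close> the quadratic side
      is at most half of the linear one; the added 1 keeps the denominator positive whatever
      \<open>d\<close> is.\<close>
    have "2 * (1 / (\<bar>d\<bar> + 1)) * (w \<bullet> w) * (w \<bullet> w) \<le> (w \<bullet> w / (\<bar>d\<bar> + 1))\<^sup>2 * d"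
      using quad[of "w \<bullet> w / (\<bar>d\<bar> + 1)"] by (simp add: field_simps)
    also have "\<dots> \<le> (w \<bullet> w / (\<bar>d\<bar> + 1))\<^sup>2 * (\<bar>d\<bar> + 1)"
      by (intro mult_left_mono) auto
    also have "\<dots> = 1 / (\<bar>d\<bar> + 1) * (w \<bullet> w) * (w \<bullet> w)"
      by (simp add: power2_eq_square)
    finally show False
      using mult_pos_pos[OF mult_pos_pos[OF divide_pos_pos[OF zero_less_one \<open>\<bar>d\<bar> + 1 > 0\<close>] pos] pos]
      by simp
  qed
  then have "f v = l *\<^sub>R v" by (simp add: w_def)
  with v that show thesis by auto
qed

text \<open>The orthogonal complement of a set of eigenvectors is invariant because \<open>f\<close>
  is self-adjoint, and it is non-zero as long as fewer than \<open>DIM('a)\<close> vectors have been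
  chosen.\<close>

lemma orthonormal_eigenvectors_exist:
  fixes f :: "'a::euclidean_space \<Rightarrow> 'a"
  assumes "linear f" and sym: "\<And>x y. f x \<bullet> y = x \<bullet> f y"
    and "k \<le> DIM('a)"
  shows "\<exists>B. finite B \<and> card B = k \<and> pairwise orthogonal B \<and>
           (\<forall>b\<in>B. norm b = 1 \<and> (\<exists>l. f b = l *\<^sub>R b))"
  using \<open>k \<le> DIM('a)\<close>
proof (induction k)
  case 0
  show ?case by (intro exI[of _ "{}"]) auto
next
  case (Suc k)
  then obtain B where B: "finite B" "card B = k" "pairwise orthogonal B"
      "\<And>b. b \<in> B \<Longrightarrow> norm b = 1" "\<And>b. b \<in> B \<Longrightarrow> \<exists>l. f b = l *\<^sub>R b"
    by auto
  define V where "V = {v. \<forall>b\<in>B. b \<bullet> v = 0}"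
  have "subspace V"
    by (auto simp: V_def subspace_def inner_simps)
  moreover have "f ` V \<subseteq> V"
  proof
    fix y assume "y \<in> f ` V"
    then obtain v where v: "y = f v" "\<And>b. b \<in> B \<Longrightarrow> b \<bullet> v = 0" by (auto simp: V_def)
    have "b \<bullet> f v = 0" if b: "b \<in> B" for b
      using B(5)[OF b] v(2)[OF b] by (auto simp: sym[symmetric])
    then show "y \<in> V" by (simp add: V_def v)
  qed
  moreover have "V \<noteq> {0}"
  proof -
    have "dim B < DIM('a)"
      using dim_le_card'[OF B(1)] B(2) Suc.prems by simp
    then obtain x where "x \<noteq> 0" "\<And>y. y \<in> span B \<Longrightarrow> orthogonal x y"
      using orthogonal_to_subspace_exists by blast
    then have "x \<in> V"
      by (auto simp: V_def orthogonal_def inner_commute span_base)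
    with \<open>x \<noteq> 0\<close> show ?thesis by blast
  qed
  ultimately obtain v l where v: "v \<in> V" "norm v = 1" "f v = l *\<^sub>R v"
    using self_adjoint_eigenvector_in_subspace[OF assms(1) sym] by blast
  have "v \<notin> B"
    using v(1,2) by (auto simp: V_def norm_eq_1)
  have "pairwise orthogonal (insert v B)"
    using B(3) v(1) by (auto simp: pairwise_insert V_def orthogonal_def inner_commute)
  with B v \<open>v \<notin> B\<close> show ?case
    by (intro exI[of _ "insert v B"]) auto
qed

definition diag_matrix :: "('n \<Rightarrow> 'a::zero) \<Rightarrow> 'a^'n^'n" where
  "diag_matrix d = (\<chi> i j. if i = j then d i else 0)"

lemma symmetric_matrix_diagonalization:
  fixes M :: "real^'n^'n"
  assumes "transpose M = M"
  obtains P l where "orthogonal_matrix P" "M = P ** diag_matrix l ** transpose P"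
proof -
  have sym: "(M *v x) \<bullet> y = x \<bullet> (M *v y)" for x y
    by (metis assms dot_lmul_matrix matrix_transpose_mul transpose_matrix_vector)
  obtain B where B: "finite B" "card B = CARD('n)" "pairwise orthogonal B"
      "\<And>b. b \<in> B \<Longrightarrow> norm b = 1" "\<And>b. b \<in> B \<Longrightarrow> \<exists>l. M *v b = l *\<^sub>R b"
    using orthonormal_eigenvectors_exist[of "(*v) M" "CARD('n)", OF matrix_vector_mul_linear sym] by auto
  obtain b where b: "bij_betw b (UNIV :: 'n set) B"
    using B(1,2) finite_same_card_bij[of "UNIV :: 'n set" B] by auto
  then have bB: "b i \<in> B" for i by (auto simp: bij_betw_def)
  define l where "l i = (SOME l. M *v b i = l *\<^sub>R b i)" for i
  have l: "M *v b i = l i *\<^sub>R b i" for i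
    unfolding l_def using someI_ex[OF B(5)[OF bB]] .
  define P :: "real^'n^'n" where "P = (\<chi> i j. b j $ i)"
  have col: "column j P = b j" for j
    by (simp add: P_def column_def)
  have orth: "orthogonal_matrix P"
    unfolding orthogonal_matrix_orthonormal_columns col
    using B(3,4) bB b by (auto simp: pairwise_def bij_betw_def inj_eq)
  have "M ** P = P ** diag_matrix l"
  proof -
    have "(M ** P) $ i $ j = (P ** diag_matrix l) $ i $ j" for i j
      using arg_cong[OF l[of j], of "\<lambda>v. v $ i"]
      by (simp add: P_def diag_matrix_def matrix_matrix_mult_def matrix_vector_mult_def
          if_distrib[of "(*) _"] mult.commute cong: if_cong)
    then show ?thesis by (simp add: vec_eq_iff)
  qed
  then have "M ** (P ** transpose P) = P ** diag_matrix l ** transpose P"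
    by (simp add: matrix_mul_assoc)
  then show thesis
    using that orth by (simp add: orthogonal_matrix_def)
qed

section \<open>Characteristic polynomial and singular values in an eigenbasis\<close>

lemma charpoly_diagonalization:
  fixes P :: "real^'n^'n"
  assumes "orthogonal_matrix P"
  shows "charpoly (P ** diag_matrix l ** transpose P) = (\<Prod>i\<in>UNIV. [:- l i, 1:])"
proof -
  let ?c = "map_matrix (\<lambda>a. [:a:]) :: real^'n^'n \<Rightarrow> real poly^'n^'n"
  have const_sum: "[:sum f A:] = (\<Sum>i\<in>A. [:f i:])" for f :: "'n \<Rightarrow> real" and A
    by (simp add: poly_eq_iff coeff_sum coeff_pCons split: nat.split)
  have mult: "?c (A ** B) = ?c A ** ?c B" for A B
    by (simp add: vec_eq_iff matrix_matrix_mult_def const_sum mult.commute)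
  have diff_l: "A ** (B - C) = A ** B - A ** C" and diff_r: "(A - B) ** C = A ** C - B ** C"
    for A B C :: "real poly^'n^'n"
    by (simp_all add: vec_eq_iff matrix_matrix_mult_def algebra_simps sum_subtractf)
  have one: "?c (mat 1) = mat 1"
    by (simp add: vec_eq_iff mat_def)
  have PP: "?c P ** ?c (transpose P) = mat 1"
    using assms by (simp add: mult[symmetric] orthogonal_matrix_def one)
  let ?X = "mat (monom 1 1) :: real poly^'n^'n"
  have comm: "?X ** A = A ** ?X" for A
    by (simp add: vec_eq_iff matrix_matrix_mult_def mat_def if_distrib[of "\<lambda>x. _ * x"]
        if_distrib[of "\<lambda>x. x * _"] mult.commute cong: if_cong)
  \<comment> \<open>The scalar matrix \<open>?X\<close> commutes with everything, so the conjugation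
    by \<open>P\<close> can be pulled out of the whole difference and disappears in the
    determinant.\<close>
  have "?X - ?c (P ** diag_matrix l ** transpose P)
      = ?c P ** (?X - ?c (diag_matrix l)) ** ?c (transpose P)"
    by (simp only: mult diff_l diff_r comm[of "?c P", symmetric] matrix_mul_assoc)
      (simp only: matrix_mul_assoc[symmetric] PP matrix_mul_rid)
  then have "charpoly (P ** diag_matrix l ** transpose P)
      = det (?c P ** ?c (transpose P)) * det (?X - ?c (diag_matrix l))"
    by (simp add: charpoly_def det_mul mult_ac)
  also have "\<dots> = (\<Prod>i\<in>UNIV. [:- l i, 1:])"
    unfolding PP det_I mult_1
    by (subst det_diagonal) (auto simp: diag_matrix_def mat_def monom_altdef)
  finally show ?thesis .
qed

lemma singular_values_diagonalization:
  fixes S :: "real^'n^'m"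
  assumes "orthogonal_matrix P" "transpose S ** S = P ** diag_matrix l ** transpose P"
  shows "singular_values S = image_mset (\<lambda>i. sqrt (l i)) (mset_set UNIV)"
proof -
  have "proots (\<Prod>i\<in>UNIV. [:- l i, 1:]) = (\<Sum>i\<in>UNIV. {#l i#})"
    by (subst proots_prod) auto
  also have "\<dots> = image_mset l (mset_set UNIV)"
    by (simp add: sum_unfold_sum_mset)
  finally show ?thesis
    by (simp add: singular_values_def assms charpoly_diagonalization image_mset.compositionality o_def)
qed

section \<open>Second-order frequency integrals\<close>

lemma DERIV_arctan_scaled:
  fixes a d :: real
  assumes "a > 0" "d > 0"
  shows "((\<lambda>t. arctan (a * t / d) / (a * d)) has_real_derivative 1 / ((a * t)\<^sup>2 + d\<^sup>2)) (at t)"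
proof -
  have "((\<lambda>t. a * t / d) has_real_derivative a / d) (at t)"
    using assms by (auto intro!: derivative_eq_intros)
  from DERIV_cdivide[OF DERIV_chain2[OF DERIV_arctan this], of "a * d"]
  have "((\<lambda>t. arctan (a * t / d) / (a * d)) has_real_derivative
      inverse (1 + (a * t / d)\<^sup>2) * (a / d) / (a * d)) (at t)" .
  moreover have "1 + (a * t / d)\<^sup>2 = ((a * t)\<^sup>2 + d\<^sup>2) / d\<^sup>2"
    using assms by (simp add: power_divide add_divide_distrib)
  ultimately show ?thesis
    using assms by (simp add: power2_eq_square)
qed

text \<open>Here \<open>c\<close> will be the discriminant \<open>b1\<^sup>2 - 4 * b0 * b2\<close>,
  whose sign depends on how damped the mode is. Stating only the existence of a primitive vanishing
  at infinity confines the three closed forms to this proof.\<close>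

lemma inverse_quadratic_primitive:
  fixes c t0 :: real
  assumes "t0 > 0" "t0\<^sup>2 + c > 0"
  obtains F where "\<And>t. t \<ge> t0 \<Longrightarrow> (F has_real_derivative 1 / (t\<^sup>2 + c)) (at t)"
    and "(F \<longlongrightarrow> 0) at_top"
proof (cases c "0::real" rule: linorder_cases)
  case equal
  show thesis
  proof (rule that[of "\<lambda>t. - 1 / t"])
    show "((\<lambda>t. - 1 / t) has_real_derivative 1 / (t\<^sup>2 + c)) (at t)" if "t \<ge> t0" for t
      using that assms equal by (auto intro!: derivative_eq_intros simp: power2_eq_square)
    show "((\<lambda>t. - 1 / t :: real) \<longlongrightarrow> 0) at_top" by real_asymp
  qed
next
  case greater
  define d where "d = sqrt c"
  have d: "d > 0" "c = d\<^sup>2" using greater by (auto simp: d_def)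
  show thesis
  proof (rule that[of "\<lambda>t. (arctan (t / d) - pi / 2) / d"])
    show "((\<lambda>t. (arctan (t / d) - pi / 2) / d) has_real_derivative 1 / (t\<^sup>2 + c)) (at t)" for t
      using DERIV_diff[OF DERIV_arctan_scaled[of 1 d t] DERIV_const[of "pi / 2 / d"]] d
      by (simp add: diff_divide_distrib)
    show "((\<lambda>t. (arctan (t / d) - pi / 2) / d) \<longlongrightarrow> 0) at_top"
      using d(1) by real_asymp
  qed
next
  case less
  define d where "d = sqrt (- c)"
  have d: "d > 0" "c = - d\<^sup>2" using less by (auto simp: d_def)
  have "d < t0"
    using assms d by (simp add: power2_less_imp_less)
  show thesis
  proof (rule that[of "\<lambda>t. (ln (t - d) - ln (t + d)) / (2 * d)"])
    show "((\<lambda>t. (ln (t - d) - ln (t + d)) / (2 * d)) has_real_derivative 1 / (t\<^sup>2 + c)) (at t)"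
      if "t \<ge> t0" for t
    proof -
      have "t - d > 0" "t + d > 0" using that \<open>d < t0\<close> d by auto
      moreover have "t\<^sup>2 - d\<^sup>2 = (t - d) * (t + d)" by (simp add: power2_eq_square algebra_simps)
      ultimately show ?thesis
        using d by (auto intro!: derivative_eq_intros simp: divide_simps) 
    qed
    show "((\<lambda>t. (ln (t - d) - ln (t + d)) / (2 * d)) \<longlongrightarrow> 0) at_top"
      using d(1) by real_asymp
  qed
qed

text \<open>Measurability of \<open>g\<close> comes for free, as \<open>g\<close> is
  \<open>f\<close> modified at a single point.\<close>

lemma has_bochner_integral_lborel_cong_off_point:
  fixes f g :: "real \<Rightarrow> 'b::{banach, second_countable_topology}"
  assumes f: "has_bochner_integral lborel f x" and eq: "\<And>w. w \<noteq> c \<Longrightarrow> g w = f w"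
  shows "has_bochner_integral lborel g x"
proof -
  have [measurable]: "f \<in> borel_measurable borel"
    using borel_measurable_has_bochner_integral[OF f] by simp
  have "g = (\<lambda>w. if w = c then g c else f w)"
    by (auto simp: eq)
  also have "\<dots> \<in> borel_measurable lborel"
    by measurable
  finally show ?thesis
    using f borel_measurable_has_bochner_integral[OF f] AE_lborel_singleton[of c]
    by (subst has_bochner_integral_cong_AE[of g lborel f]) (auto simp: eq elim!: AE_mp)
qed

text \<open>The primitives used below are singular at 0, so only one-sided limits are required of
  \<open>F\<close>. Nonnegativity of \<open>f\<close> yields integrability together with the
  value.\<close>

lemma has_bochner_integral_even_FTC:
  fixes f F :: "real \<Rightarrow> real"
  assumes deriv: "\<And>w. w > 0 \<Longrightarrow> (F has_real_derivative f w) (at w)"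
    and cont: "\<And>w. w > 0 \<Longrightarrow> isCont f w"
    and nonneg: "\<And>w. w > 0 \<Longrightarrow> f w \<ge> 0"
    and even: "\<And>w. f (- w) = f w"
    and lim: "(F \<longlongrightarrow> a) (at_right 0)" "(F \<longlongrightarrow> b) at_top"
  shows "has_bochner_integral lborel f (2 * (b - a))"
proof -
  have A: "((F \<circ> real_of_ereal) \<longlongrightarrow> a) (at_right 0)"
    using lim(1) by (simp add: ereal_tendsto_simps zero_ereal_def)
  have B: "((F \<circ> real_of_ereal) \<longlongrightarrow> b) (at_left \<infinity>)"
    using lim(2) by (simp add: ereal_tendsto_simps)
  have AE: "AE x in lborel. (0::ereal) < ereal x \<longrightarrow> ereal x < \<infinity> \<longrightarrow> 0 \<le> f x"
    by (auto simp: nonneg)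
  have int: "set_integrable lborel (einterval 0 \<infinity>) f" "(LBINT x=0..\<infinity>. f x) = b - a"
    by (rule interval_integral_FTC_nonneg[OF _ _ _ AE A B]; simp add: deriv cont)+
  have "has_bochner_integral lborel (\<lambda>x. indicator {0<..} x *\<^sub>R f x) (b - a)"
    using int by (simp add: interval_lebesgue_integral_def set_integrable_def
        set_lebesgue_integral_def has_bochner_integral_iff einterval_def greaterThan_def)
  \<comment> \<open>The rule for even functions works with the closed half-line; adding the endpoint
    changes the integrand only at 0.\<close>
  then have "has_bochner_integral lborel (\<lambda>x. indicator {0..} x *\<^sub>R f x) (b - a)"
    by (rule has_bochner_integral_lborel_cong_off_point[where c = 0]) (auto split: split_indicator)
  from has_bochner_integral_even_function[OF this even] show ?thesis
    by simp
qed

text \<open>The value \<open>|b2 s\<^sup>2 + b1 s + b0|\<^sup>2\<close> at \<open>s = \<i> w\<close>.\<close>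

definition quadratic_abs_sq :: "real \<Rightarrow> real \<Rightarrow> real \<Rightarrow> real \<Rightarrow> real" where
  "quadratic_abs_sq b2 b1 b0 w = (b0 - b2 * w\<^sup>2)\<^sup>2 + (b1 * w)\<^sup>2"

text \<open>Two combinations of the integrands have elementary primitives: with
  \<open>\<phi> = (b2 w\<^sup>2 - b0) / (b1 w)\<close>, the derivative of \<open>arctan \<phi>\<close> is \<open>b1 (b2 w\<^sup>2 + b0)\<close> over the
  denominator, and with \<open>\<psi> = (b2 w\<^sup>2 + b0) / w\<close> the denominator is \<open>w\<^sup>2 (\<psi>\<^sup>2 + b1\<^sup>2 - 4 b0 b2)\<close>.
  Since \<open>\<psi>\<close> tends to infinity both at \<open>0\<close> and at infinity, the second combination
  \<open>b2 w\<^sup>2 - b0\<close> contributes nothing.\<close>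

lemma has_bochner_integral_quadratic_abs_sq:
  fixes b0 b1 b2 :: real
  assumes pos: "b2 > 0" "b1 > 0" "b0 > 0"
  shows "has_bochner_integral lborel (\<lambda>w. w\<^sup>2 / quadratic_abs_sq b2 b1 b0 w) (pi / (b1 * b2))"
    and "has_bochner_integral lborel (\<lambda>w. 1 / quadratic_abs_sq b2 b1 b0 w) (pi / (b1 * b0))"
proof -
  let ?D = "quadratic_abs_sq b2 b1 b0"
  have D_pos: "?D w > 0" if "w > 0" for w
    using that pos by (simp add: quadratic_abs_sq_def add_nonneg_pos)
  have D_even: "?D (- w) = ?D w" for w
    by (simp add: quadratic_abs_sq_def)
  \<comment> \<open>The minimum of \<open>\<psi>\<close> on the positive axis, by the inequality of
    arithmetic and geometric means; with it \<open>t0\<^sup>2 + (b1\<^sup>2 - 4 * b0 * b2)\<close>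
    is just \<open>b1\<^sup>2\<close>.\<close>
  define t0 where "t0 = 2 * sqrt (b0 * b2)"
  have t0: "t0 > 0" "t0\<^sup>2 + (b1\<^sup>2 - 4 * b0 * b2) > 0"
    using pos by (auto simp: t0_def power_mult_distrib)
  obtain H where H: "\<And>t. t \<ge> t0 \<Longrightarrow> (H has_real_derivative 1 / (t\<^sup>2 + (b1\<^sup>2 - 4 * b0 * b2))) (at t)"
      and H_lim: "(H \<longlongrightarrow> 0) at_top"
    using inverse_quadratic_primitive[OF t0] by metis
  define \<phi> where "\<phi> w = (b2 * w\<^sup>2 - b0) / (b1 * w)" for w
  define \<psi> where "\<psi> w = (b2 * w\<^sup>2 + b0) / w" for w
  have \<psi>_ge: "\<psi> w \<ge> t0" if "w > 0" for w
  proof -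
    have "t0 * w = 2 * (sqrt b2 * w) * sqrt b0"
      by (simp add: t0_def real_sqrt_mult)
    also have "\<dots> \<le> (sqrt b2 * w)\<^sup>2 + (sqrt b0)\<^sup>2"
      by (rule sum_squares_bound)
    also have "\<dots> = b2 * w\<^sup>2 + b0"
      using pos by (simp add: power_mult_distrib)
    finally show ?thesis using that by (simp add: \<psi>_def pos_le_divide_eq)
  qed
  have d\<phi>: "((\<lambda>w. arctan (\<phi> w)) has_real_derivative b1 * (b2 * w\<^sup>2 + b0) / ?D w) (at w)" if "w > 0" for w
  proof -
    have "1 + (\<phi> w)\<^sup>2 = ?D w / (b1 * w)\<^sup>2"
      using that pos by (simp add: \<phi>_def quadratic_abs_sq_def field_simps) algebra
    moreover have "(\<phi> has_real_derivative (b2 * w\<^sup>2 + b0) / (b1 * w\<^sup>2)) (at w)"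
      unfolding \<phi>_def using that pos
      by (auto intro!: derivative_eq_intros simp: field_simps power2_eq_square)
    ultimately show ?thesis
      using that pos DERIV_chain2[OF DERIV_arctan, of \<phi>] by (fastforce simp: power2_eq_square)
  qed
  have d\<psi>: "((\<lambda>w. H (\<psi> w)) has_real_derivative (b2 * w\<^sup>2 - b0) / ?D w) (at w)" if "w > 0" for w
  proof -
    have *: "(\<psi> w)\<^sup>2 + (b1\<^sup>2 - 4 * b0 * b2) = ?D w / w\<^sup>2"
      using that pos by (simp add: \<psi>_def quadratic_abs_sq_def field_simps) algebra
    have "(\<psi> has_real_derivative (b2 * w\<^sup>2 - b0) / w\<^sup>2) (at w)"
      unfolding \<psi>_def using that pos
      by (auto intro!: derivative_eq_intros simp: field_simps power2_eq_square)
    from DERIV_chain2[OF H[OF \<psi>_ge[OF that]] this] show ?thesis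
      using that by (simp add: *)
  qed
  define \<alpha> where "\<alpha> w = arctan (\<phi> w)" for w
  define \<beta> where "\<beta> w = H (\<psi> w)" for w
  note d\<alpha> = d\<phi>[folded \<alpha>_def] and d\<beta> = d\<psi>[folded \<beta>_def]
  have cont: "isCont ?D w" for w
    unfolding quadratic_abs_sq_def by (intro continuous_intros)
  have \<alpha>_lim: "((\<lambda>w. \<alpha> w) \<longlongrightarrow> - (pi / 2)) (at_right 0)" "((\<lambda>w. \<alpha> w) \<longlongrightarrow> pi / 2) at_top"
    unfolding \<alpha>_def \<phi>_def using pos by real_asymp+
  have "filterlim \<psi> at_top (at_right 0)" "filterlim \<psi> at_top at_top"
    unfolding \<psi>_def using pos by real_asymp+
  then have \<beta>_lim: "((\<lambda>w. \<beta> w) \<longlongrightarrow> 0) (at_right 0)" "((\<lambda>w. \<beta> w) \<longlongrightarrow> 0) at_top"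
    unfolding \<beta>_def using H_lim filterlim_compose by blast+
  \<comment> \<open>Adding the two primitives cancels \<open>b0\<close> in the numerator and leaves
    \<open>2 * b2 * w\<^sup>2\<close>; subtracting them, as for the second integral, leaves
    \<open>2 * b0\<close>. The only increment comes from \<open>\<alpha>\<close>, which rises by
    \<open>pi\<close>.\<close>
  have "has_bochner_integral lborel (\<lambda>w. w\<^sup>2 / ?D w)
      (2 * ((pi / 2 / b1 + 0) / (2 * b2) - (- (pi / 2) / b1 + 0) / (2 * b2)))"
  proof (rule has_bochner_integral_even_FTC)
    show "((\<lambda>w. (\<alpha> w / b1 + \<beta> w) / (2 * b2)) has_real_derivative w\<^sup>2 / ?D w) (at w)"
      if "w > 0" for w
      using D_pos[OF that] pos
      by (auto intro!: derivative_eq_intros d\<alpha> d\<beta> that simp: field_simps)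
    show "isCont (\<lambda>w. w\<^sup>2 / ?D w) w" if "w > 0" for w
      using D_pos[OF that] by (intro continuous_intros cont) auto
    show "w\<^sup>2 / ?D w \<ge> 0" if "w > 0" for w
      using D_pos[OF that] by simp
    show "((\<lambda>w. (\<alpha> w / b1 + \<beta> w) / (2 * b2)) \<longlongrightarrow> (- (pi / 2) / b1 + 0) / (2 * b2)) (at_right 0)"
      "((\<lambda>w. (\<alpha> w / b1 + \<beta> w) / (2 * b2)) \<longlongrightarrow> (pi / 2 / b1 + 0) / (2 * b2)) at_top"
      using pos by (intro tendsto_intros \<alpha>_lim \<beta>_lim; simp)+
  qed (simp add: D_even)
  then show "has_bochner_integral lborel (\<lambda>w. w\<^sup>2 / ?D w) (pi / (b1 * b2))"
    by (simp add: field_simps)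
  have "has_bochner_integral lborel (\<lambda>w. 1 / ?D w)
      (2 * ((pi / 2 / b1 - 0) / (2 * b0) - (- (pi / 2) / b1 - 0) / (2 * b0)))"
  proof (rule has_bochner_integral_even_FTC)
    show "((\<lambda>w. (\<alpha> w / b1 - \<beta> w) / (2 * b0)) has_real_derivative 1 / ?D w) (at w)"
      if "w > 0" for w
      using D_pos[OF that] pos
      by (auto intro!: derivative_eq_intros d\<alpha> d\<beta> that simp: field_simps)
    show "isCont (\<lambda>w. 1 / ?D w) w" if "w > 0" for w
      using D_pos[OF that] by (intro continuous_intros cont) auto
    show "1 / ?D w \<ge> 0" if "w > 0" for w
      using D_pos[OF that] by simp
    show "((\<lambda>w. (\<alpha> w / b1 - \<beta> w) / (2 * b0)) \<longlongrightarrow> (- (pi / 2) / b1 - 0) / (2 * b0)) (at_right 0)"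
      "((\<lambda>w. (\<alpha> w / b1 - \<beta> w) / (2 * b0)) \<longlongrightarrow> (pi / 2 / b1 - 0) / (2 * b0)) at_top"
      using pos by (intro tendsto_intros \<alpha>_lim \<beta>_lim; simp)+
  qed (simp add: D_even)
  then show "has_bochner_integral lborel (\<lambda>w. 1 / ?D w) (pi / (b1 * b0))"
    by (simp add: field_simps)
qed

text \<open>For \<open>b0 = 0\<close> a factor \<open>w\<^sup>2\<close> cancels and an arctangent
  integrand remains. The weight alone is no longer integrable near 0, so there is no companion
  formula for numerator 1.\<close>

lemma has_bochner_integral_quadratic_abs_sq_degenerate:
  fixes b1 b2 :: real
  assumes pos: "b2 > 0" "b1 > 0"
  shows "has_bochner_integral lborel (\<lambda>w. w\<^sup>2 / quadratic_abs_sq b2 b1 0 w) (pi / (b1 * b2))"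
proof -
  let ?D = "quadratic_abs_sq b2 b1 0"
  have D: "?D w = w\<^sup>2 * ((b2 * w)\<^sup>2 + b1\<^sup>2)" for w
    by (simp add: quadratic_abs_sq_def power2_eq_square algebra_simps)
  have D_pos: "(b2 * w)\<^sup>2 + b1\<^sup>2 > 0" for w
    using pos by (simp add: add_nonneg_pos)
  have "has_bochner_integral lborel (\<lambda>w. w\<^sup>2 / ?D w) (2 * (pi / 2 / (b1 * b2) - 0))"
  proof (rule has_bochner_integral_even_FTC)
    show "((\<lambda>w. arctan (b2 * w / b1) / (b1 * b2)) has_real_derivative w\<^sup>2 / ?D w) (at w)"
      if "w > 0" for w
      using DERIV_arctan_scaled[OF pos, of w] that by (simp add: D mult.commute[of b1])
    show "isCont (\<lambda>w. w\<^sup>2 / ?D w) w" if "w > 0" for w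
      unfolding D using D_pos[of w] that by (intro continuous_intros) auto
    show "w\<^sup>2 / ?D w \<ge> 0" if "w > 0" for w
      unfolding D using D_pos[of w] by simp
    show "((\<lambda>w. arctan (b2 * w / b1) / (b1 * b2)) \<longlongrightarrow> 0) (at_right 0)"
      "((\<lambda>w. arctan (b2 * w / b1) / (b1 * b2)) \<longlongrightarrow> pi / 2 / (b1 * b2)) at_top"
      using pos by (real_asymp simp: field_simps)+
  qed (auto simp: D)
  then show ?thesis by simp
qed

section \<open>Complexified block matrices and stability\<close>

lemma complex_matrix_nth [simp]: "complex_matrix A $ i $ j = complex_of_real (A $ i $ j)"
  by (simp add: complex_matrix_def)

lemma complex_matrix_transpose: "complex_matrix (transpose A) = transpose (complex_matrix A)"
  by (simp add: vec_eq_iff transpose_def)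

lemma complex_matrix_mult: "complex_matrix (A ** B) = complex_matrix A ** complex_matrix B"
  by (simp add: vec_eq_iff matrix_matrix_mult_def)

lemma complex_matrix_mat: "complex_matrix (mat a) = mat (complex_of_real a)"
  by (simp add: vec_eq_iff mat_def)

lemma complex_matrix_scaleR: "complex_matrix (a *\<^sub>R A) = a *\<^sub>R complex_matrix A"
  by (simp add: vec_eq_iff scaleR_conv_of_real[where 'a=complex])

lemma complex_matrix_add: "complex_matrix (A + B) = complex_matrix A + complex_matrix B"
  by (simp add: vec_eq_iff)

lemma complex_matrix_zero: "complex_matrix 0 = 0"
  by (simp add: vec_eq_iff)

lemma complex_matrix_block_row:
  "complex_matrix (block_row A B) = block_row (complex_matrix A) (complex_matrix B)"
  by (simp add: vec_eq_iff block_row_def stack_def split: sum.split)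

lemma complex_matrix_block_matrix:
  "complex_matrix (block_matrix A B C D)
     = block_matrix (complex_matrix A) (complex_matrix B) (complex_matrix C) (complex_matrix D)"
  by (simp add: vec_eq_iff block_matrix_def block_row_def stack_def split: sum.split)

lemmas complex_matrix_hom =
  complex_matrix_transpose complex_matrix_mult complex_matrix_mat complex_matrix_scaleR
  complex_matrix_add complex_matrix_zero complex_matrix_block_row complex_matrix_block_matrix

lemma block_row_mult_stack_semiring:
  fixes M :: "'a::semiring_1^'n^'p" and N :: "'a^'m^'p"
  shows "block_row M N *v stack x y = M *v x + N *v y"
  by (simp add: vec_eq_iff block_row_def stack_def matrix_vector_mult_def
        UNIV_Plus_UNIV[symmetric] sum.Plus del: UNIV_Plus_UNIV)

lemma block_matrix_mult_stack_semiring: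
  fixes M11 :: "'a::semiring_1^'n^'p" and M12 :: "'a^'m^'p" and M21 :: "'a^'n^'q" and M22 :: "'a^'m^'q"
  shows "block_matrix M11 M12 M21 M22 *v stack x y
           = stack (M11 *v x + M12 *v y) (M21 *v x + M22 *v y)"
proof -
  have "(block_matrix M11 M12 M21 M22 *v stack x y) $ i
          = stack (block_row M11 M12 *v stack x y) (block_row M21 M22 *v stack x y) $ i" for i
    by (cases i) (simp_all add: block_matrix_def matrix_vector_mult_def stack_def)
  then show ?thesis
    by (simp add: vec_eq_iff block_row_mult_stack_semiring)
qed

lemma stack_cases:
  obtains x y where "v = stack x y"
proof
  show "v = stack (\<chi> i. v $ Inl i) (\<chi> i. v $ Inr i)"
    by (simp add: vec_eq_iff stack_def split: sum.split)
qed

lemma scalar_mult_stack: "a *s stack x y = stack (a *s x) (a *s y)"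
  by (simp add: vec_eq_iff stack_def split: sum.split)

lemma diff_stack: "stack x y - stack x' y' = stack (x - x') (y - y')"
  by (simp add: vec_eq_iff stack_def split: sum.split)

lemma stack_eq_zero_iff:
  fixes x :: "'a::zero^'n" and y :: "'a^'m"
  shows "stack x y = 0 \<longleftrightarrow> x = 0 \<and> y = 0"
proof -
  have "(0 :: 'a^('n + 'm)) = stack 0 0"
    by (simp add: vec_eq_iff stack_def split: sum.split)
  then show ?thesis by (metis stack_eq_iff)
qed

lemma scaleR_matrix_vector_mult:
  fixes A :: "complex^'n^'m"
  shows "(a *\<^sub>R A) *v x = a *\<^sub>R (A *v x)"
  by (simp add: vec_eq_iff matrix_vector_mult_def scaleR_sum_right)

lemma mat_mult_vec: "(mat a :: 'a::comm_semiring_1^'n^'n) *v x = a *s x"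
  by (simp add: vec_eq_iff mat_def matrix_vector_mult_def if_distrib[of "\<lambda>x. x * _"] cong: if_cong)

lemma complex_aug_A_mult:
  "complex_matrix (aug_A q tx tn \<rho> S) *v stack x n = stack
     (- (1 / tx) *\<^sub>R (q *\<^sub>R x + \<rho> *\<^sub>R (transpose (complex_matrix S) *v (complex_matrix S *v x))
        + transpose (complex_matrix S) *v n))
     ((1 / tn) *\<^sub>R (complex_matrix S *v x))"
  by (simp only: aug_A_def complex_matrix_hom block_matrix_mult_stack_semiring
      scaleR_matrix_vector_mult matrix_vector_mult_add_rdistrib matrix_vector_mul_assoc[symmetric])
    (simp add: mat_mult_vec algebra_simps del: transpose_matrix_vector)

lemma complex_aug_B_mult:
  "complex_matrix (aug_B tx tn \<rho> tb tc S) *v stack ec eb = stack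
     ((- tc / tx) *\<^sub>R ec + (\<rho> * tb / tx) *\<^sub>R (transpose (complex_matrix S) *v eb))
     ((- tb / tn) *\<^sub>R eb)"
  by (simp only: aug_B_def complex_matrix_hom block_matrix_mult_stack_semiring
      scaleR_matrix_vector_mult) simp

lemma complex_aug_C_mult:
  "complex_matrix (aug_C q) *v stack x n = sqrt q *\<^sub>R x"
  by (simp add: aug_C_def complex_matrix_hom block_row_mult_stack_semiring scaleR_matrix_vector_mult)

text \<open>The inner product on \<open>complex^'n\<close> is the real part of the Hermitian one, so
  the imaginary part of \<open>a\<close> turns \<open>x\<close> into an orthogonal direction. This
  extracts real parts of eigenvalues without conjugates.\<close>

lemma inner_scalar_mult_self:
  fixes x :: "complex^'n"
  shows "(a *s x) \<bullet> x = Re a * (x \<bullet> x)"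
  by (simp add: inner_vec_def inner_complex_def sum_distrib_left algebra_simps)

lemma inner_complex_matrix_transpose:
  fixes S :: "real^'n^'m"
  shows "(transpose (complex_matrix S) *v y) \<bullet> x = y \<bullet> (complex_matrix S *v x)"
proof -
  have *: "(of_real a * z) \<bullet> w = z \<bullet> (of_real a * w)" for a and z w :: complex
    by (simp add: inner_complex_def)
  show ?thesis
    by (simp add: inner_vec_def matrix_vector_mult_def transpose_def inner_sum_left
        inner_sum_right *) (rule sum.swap)
qed

text \<open>Since \<open>S\<close> is real, real and imaginary parts of \<open>y\<close> lie
  separately in the kernel of its transpose, which full row rank makes trivial.\<close>

lemma complex_transpose_full_row_rank:
  fixes S :: "real^'n^'m"
  assumes "rank S = CARD('m)" "transpose (complex_matrix S) *v y = 0"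
  shows "y = 0"
proof -
  have "rank (transpose S) = CARD('m)"
    using assms(1) by (simp add: rank_transpose)
  then have inj: "z = 0" if "transpose S *v z = 0" for z
    using that by (metis full_rank_injective injD matrix_vector_mult_0_right)
  have comp: "(\<Sum>j\<in>UNIV. of_real (S $ j $ i) * y $ j) = 0" for i
    using arg_cong[OF assms(2), of "\<lambda>v. v $ i"] by (simp add: matrix_vector_mult_def transpose_def)
  have "transpose S *v (\<chi> j. Re (y $ j)) = 0"
    using arg_cong[OF comp, of Re] by (simp add: vec_eq_iff matrix_vector_mult_def transpose_def)
  moreover have "transpose S *v (\<chi> j. Im (y $ j)) = 0"
    using arg_cong[OF comp, of Im] by (simp add: vec_eq_iff matrix_vector_mult_def transpose_def)
  ultimately have "(\<chi> j. Re (y $ j)) = 0" "(\<chi> j. Im (y $ j)) = 0"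
    using inj by blast+
  then show ?thesis
    by (simp add: vec_eq_iff complex_eq_iff)
qed

lemma hurwitz_aug_A:
  fixes S :: "real^'x^'r"
  assumes "rank S = CARD('r)" and pos: "q > 0" "tx > 0" "tn > 0" "\<rho> \<ge> 0"
  shows "hurwitz (aug_A q tx tn \<rho> S)"
  unfolding hurwitz_def
proof (intro allI impI)
  fix l and v :: "complex^('x + 'r)"
  assume "v \<noteq> 0" and eig: "complex_matrix (aug_A q tx tn \<rho> S) *v v = l *s v"
  obtain x n where v: "v = stack x n" by (rule stack_cases)
  let ?S = "complex_matrix S"
  have 1: "l *s x = - (1 / tx) *\<^sub>R (q *\<^sub>R x + \<rho> *\<^sub>R (transpose ?S *v (?S *v x)) + transpose ?S *v n)"
    and 2: "l *s n = (1 / tn) *\<^sub>R (?S *v x)"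
    using eig by (simp_all add: v complex_aug_A_mult scalar_mult_stack stack_eq_iff)
  \<comment> \<open>This makes the energy decay strict: with \<open>x = 0\<close> the first equation
    leaves only the transpose acting on \<open>n\<close>, and full row rank forces
    \<open>n = 0\<close>.\<close>
  have "x \<noteq> 0"
  proof
    assume "x = 0"
    then have "transpose ?S *v n = 0" using 1 pos by simp
    then have "n = 0" by (rule complex_transpose_full_row_rank[OF assms(1)])
    with \<open>x = 0\<close> \<open>v \<noteq> 0\<close> show False by (simp add: v stack_eq_zero_iff)
  qed
  \<comment> \<open>Pairing the equations with \<open>x\<close> and \<open>n\<close> and weighting
    by the time constants makes the coupling terms opposite, so they cancel in the sum.\<close>
  have "tx * (Re l * (x \<bullet> x)) = - (q * (x \<bullet> x) + \<rho> * ((?S *v x) \<bullet> (?S *v x)) + n \<bullet> (?S *v x))"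
    using pos by (simp add: inner_scalar_mult_self[symmetric] 1 inner_complex_matrix_transpose
        inner_add_left algebra_simps del: transpose_matrix_vector)
  moreover have "tn * (Re l * (n \<bullet> n)) = n \<bullet> (?S *v x)"
    using pos by (simp add: inner_scalar_mult_self[symmetric] 2 inner_commute)
  ultimately have "Re l * (tx * (x \<bullet> x) + tn * (n \<bullet> n))
      = - (q * (x \<bullet> x) + \<rho> * ((?S *v x) \<bullet> (?S *v x)))"
    by (simp add: algebra_simps)
  also have "\<dots> < 0"
    using pos \<open>x \<noteq> 0\<close>
      add_pos_nonneg[of "q * (x \<bullet> x)" "\<rho> * ((?S *v x) \<bullet> (?S *v x))"] by simp
  finally have "Re l * (tx * (x \<bullet> x) + tn * (n \<bullet> n)) < 0" .
  moreover have "tx * (x \<bullet> x) + tn * (n \<bullet> n) > 0"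
    using pos \<open>x \<noteq> 0\<close> by (simp add: add_pos_nonneg)
  ultimately show "Re l < 0"
    by (simp add: mult_less_0_iff)
qed

section \<open>The transfer function\<close>

text \<open>The Hurwitz property makes \<open>mat s - complex_matrix A\<close> injective on the
  closed right half-plane. A transfer function can thus be identified by exhibiting a state that
  solves the resolvent equation, without inverting a block matrix.\<close>

lemma transfer_function_mult_vec:
  assumes "hurwitz A" "Re s \<ge> 0"
    and "s *s w - complex_matrix A *v w = complex_matrix B *v u"
  shows "transfer_function A B C s *v u = complex_matrix C *v w"
proof -
  let ?R = "mat s - complex_matrix A"
  have R: "?R *v v = s *s v - complex_matrix A *v v" for v
    by (simp add: matrix_vector_mult_diff_rdistrib mat_mult_vec)
  have "v = 0" if "?R *v v = 0" for v
    using assms(1,2) that unfolding R hurwitz_def by (metis eq_iff_diff_eq_0 not_less)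
  \<comment> \<open>\<open>matrix_inv\<close> is a choice among two-sided inverses, so one must
    first be shown to exist; squareness upgrades the left inverse.\<close>
  then obtain L where "L ** ?R = mat 1"
    using matrix_left_invertible_ker by blast
  then have "?R ** L = mat 1 \<and> L ** ?R = mat 1"
    by (simp add: matrix_left_right_inverse)
  then have "matrix_inv ?R ** ?R = mat 1"
    unfolding matrix_inv_def by (rule someI2) simp
  then have "matrix_inv ?R *v (complex_matrix B *v u) = w"
    by (simp add: assms(3)[symmetric] R[symmetric] matrix_vector_mul_assoc)
  then show ?thesis
    by (simp add: transfer_function_def matrix_vector_mul_assoc[symmetric])
qed

section \<open>Functions of a diagonalized matrix\<close>

lemma diag_matrix_mult: "diag_matrix a ** diag_matrix b = diag_matrix (\<lambda>i. a i * b i :: 'a::semiring_1)"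
  by (simp add: vec_eq_iff diag_matrix_def matrix_matrix_mult_def if_distrib[of "\<lambda>x. x * _"] cong: if_cong)

lemma diag_matrix_mult_vec: "(diag_matrix a *v x) $ i = (a i * x $ i :: 'a::semiring_1)"
  by (simp add: diag_matrix_def matrix_vector_mult_def if_distrib[of "\<lambda>x. x * _"] cong: if_cong)

lemma transpose_diag_matrix: "transpose (diag_matrix a) = diag_matrix a"
  by (simp add: vec_eq_iff diag_matrix_def transpose_def)

lemma complex_matrix_diag: "complex_matrix (diag_matrix a) = diag_matrix (\<lambda>i. complex_of_real (a i))"
  by (simp add: vec_eq_iff diag_matrix_def)

lemma matrix_vector_mult_scalar: "(A :: 'a::comm_semiring_1^'n^'m) *v (c *s x) = c *s (A *v x)"
  by (simp add: vec_eq_iff matrix_vector_mult_def sum_distrib_left mult_ac)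

context
  fixes P Q :: "'a::comm_ring_1^'n^'n"
  assumes QP: "Q ** P = mat 1" and PQ: "P ** Q = mat 1"
begin

lemma conj_diag_mult:
  "(P ** diag_matrix a ** Q) ** (P ** diag_matrix b ** Q) = P ** diag_matrix (\<lambda>i. a i * b i) ** Q"
proof -
  have "(P ** diag_matrix a ** Q) ** (P ** diag_matrix b ** Q)
      = P ** diag_matrix a ** (Q ** P) ** diag_matrix b ** Q"
    by (simp add: matrix_mul_assoc)
  then show ?thesis
    by (simp add: QP diag_matrix_mult matrix_mul_assoc[symmetric])
qed

lemma trace_conj_diag: "trace (P ** diag_matrix a ** Q) = sum a UNIV"
proof -
  have "trace (P ** diag_matrix a ** Q) = trace ((Q ** P) ** diag_matrix a)"
    by (subst trace_mul_sym) (simp add: matrix_mul_assoc)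
  then show ?thesis
    by (simp add: QP trace_def diag_matrix_def)
qed

lemma conj_diag_affine_mult_vec:
  "(P ** diag_matrix (\<lambda>i. \<alpha> + \<beta> * l i) ** Q) *v x = \<alpha> *s x + \<beta> *s ((P ** diag_matrix l ** Q) *v x)"
proof -
  have "diag_matrix (\<lambda>i. \<alpha> + \<beta> * l i) *v (Q *v x) = \<alpha> *s (Q *v x) + \<beta> *s (diag_matrix l *v (Q *v x))"
    by (simp add: vec_eq_iff diag_matrix_mult_vec algebra_simps)
  then have "(P ** diag_matrix (\<lambda>i. \<alpha> + \<beta> * l i) ** Q) *v x
      = \<alpha> *s (P *v (Q *v x)) + \<beta> *s (P *v (diag_matrix l *v (Q *v x)))"
    by (simp add: matrix_vector_mul_assoc[symmetric] matrix_vector_right_distrib matrix_vector_mult_scalar)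
  then show ?thesis
    by (simp add: matrix_vector_mul_assoc matrix_mul_assoc PQ)
qed

end

lemma trace_transpose_block_row:
  fixes M M' :: "'a::comm_semiring_1^'n^'p" and N N' :: "'a^'m^'p"
  shows "trace (transpose (block_row M' N') ** block_row M N)
    = trace (transpose M' ** M) + trace (transpose N' ** N)"
  by (simp add: trace_def matrix_matrix_mult_def transpose_def block_row_def stack_def
        UNIV_Plus_UNIV[symmetric] sum.Plus del: UNIV_Plus_UNIV)

text \<open>The eigenvalue at \<open>l\<close> of \<open>tx tn s\<^sup>2 + tn s (q + \<rho> S\<^sup>T S) + S\<^sup>T S\<close>, which is
  what \<open>x\<close> is multiplied by after eliminating \<open>\<nu>\<close> from the Laplace-transformed dynamics and
  multiplying through by \<open>tn s\<close>.\<close>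

definition mode_denom :: "real \<Rightarrow> real \<Rightarrow> real \<Rightarrow> real \<Rightarrow> real \<Rightarrow> complex \<Rightarrow> complex" where
  "mode_denom q tx tn \<rho> l s = of_real (tx * tn) * s\<^sup>2 + of_real (tn * (q + \<rho> * l)) * s + of_real l"

text \<open>The coefficients are real, so the values at opposite imaginary points are conjugate and
  their product is a squared modulus.\<close>

lemma mode_denom_conjugate:
  "mode_denom q tx tn \<rho> l (- (\<i> * of_real w)) * mode_denom q tx tn \<rho> l (\<i> * of_real w)
     = of_real (quadratic_abs_sq (tx * tn) (tn * (q + \<rho> * l)) l w)"
  by (simp add: mode_denom_def quadratic_abs_sq_def power2_eq_square algebra_simps)

text \<open>The damping term alone suffices: it is the imaginary part, and \<open>q > 0\<close>
  keeps it non-zero even for \<open>l = 0\<close>.\<close>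

lemma mode_denom_nonzero:
  assumes "q > 0" "tn > 0" "\<rho> \<ge> 0" "l \<ge> 0" "w \<noteq> 0"
  shows "mode_denom q tx tn \<rho> l (\<i> * of_real w) \<noteq> 0"
proof -
  have "Im (mode_denom q tx tn \<rho> l (\<i> * of_real w)) = tn * (q + \<rho> * l) * w"
    by (simp add: mode_denom_def power2_eq_square)
  also have "\<dots> \<noteq> 0"
    using assms by (simp add: add_pos_nonneg order_less_imp_not_eq2)
  finally show ?thesis by auto
qed

lemma transfer_function_aug:
  fixes S :: "real^'x^'r" and P :: "real^'x^'x"
  assumes "rank S = CARD('r)" and pos: "q > 0" "tx > 0" "tn > 0" "\<rho> \<ge> 0"
    and orth: "orthogonal_matrix P" and SS: "transpose S ** S = P ** diag_matrix l ** transpose P"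
    and s: "Re s \<ge> 0" "s \<noteq> 0" and nz: "\<And>i. mode_denom q tx tn \<rho> (l i) s \<noteq> 0"
  defines "T \<equiv> \<lambda>a. complex_matrix P ** diag_matrix (\<lambda>i. a / mode_denom q tx tn \<rho> (l i) s)
                   ** transpose (complex_matrix P)"
  shows "transfer_function (aug_A q tx tn \<rho> S) (aug_B tx tn \<rho> tb tc S) (aug_C q :: real^('x + 'r)^'x) s
    = block_row (T (- of_real (sqrt q * tc * tn) * s))
        (T (of_real (sqrt q * tb) * (of_real (\<rho> * tn) * s + 1)) ** transpose (complex_matrix S))"
    (is "?G = block_row (T ?a) (T ?b ** ?S')")
proof -
  let ?S = "complex_matrix S" and ?P = "complex_matrix P"
  let ?d = "\<lambda>i. mode_denom q tx tn \<rho> (l i) s"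
  have PQ: "?P ** transpose ?P = mat 1" and QP: "transpose ?P ** ?P = mat 1"
    using orth by (simp_all add: complex_matrix_hom(1-3)[symmetric] orthogonal_matrix_def)
      (simp_all add: complex_matrix_mat)
  have M: "?P ** diag_matrix (\<lambda>i. of_real (l i)) ** transpose ?P = ?S' ** ?S"
    by (simp add: complex_matrix_diag[symmetric] complex_matrix_hom(1-2)[symmetric] SS)
  have "?G *v u = block_row (T ?a) (T ?b ** ?S') *v u" for u
  proof -
    obtain ec eb where u: "u = stack ec eb" by (rule stack_cases)
    define a where "a = - of_real (tc * tn) * s"
    define b where "b = of_real tb * (of_real (\<rho> * tn) * s + 1)"
    define g where "g = ?S' *v eb"
    \<comment> \<open>The candidate state: \<open>x\<close> is read off the claimed formula without
      its factor \<open>sqrt q\<close>, and \<open>n\<close> below solves the second equation, which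
      needs \<open>s \<noteq> 0\<close>.\<close>
    define x where "x = T a *v ec + T b *v g"
    define m where "m = ?S' *v (?S *v x)"
    define n where "n = (1 / (of_real tn * s)) *s (?S *v x - of_real tb *s eb)"
    \<comment> \<open>The mode polynomial is affine in the eigenvalue; regrouping it so turns the
      diagonalized operator into \<alpha> times the identity plus \<beta> times S^T S.\<close>
    define \<alpha> where "\<alpha> = of_real (tx * tn) * s\<^sup>2 + of_real (tn * q) * s"
    define \<beta> where "\<beta> = of_real (tn * \<rho>) * s + 1"
    have d: "?d = (\<lambda>i. \<alpha> + \<beta> * of_real (l i))"
      by (simp add: fun_eq_iff mode_denom_def \<alpha>_def \<beta>_def algebra_simps)
    have inv: "(?P ** diag_matrix ?d ** transpose ?P) *v (T c *v z) = c *s z" for c z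
    proof -
      have "(?P ** diag_matrix ?d ** transpose ?P) ** T c = ?P ** diag_matrix (\<lambda>i. c) ** transpose ?P"
        unfolding T_def conj_diag_mult[OF QP PQ] using nz by simp
      then show ?thesis
        using conj_diag_affine_mult_vec[OF QP PQ, of c 0 "\<lambda>_. 0" z] by (simp add: matrix_vector_mul_assoc)
    qed
    have "\<alpha> *s x + \<beta> *s m = (?P ** diag_matrix ?d ** transpose ?P) *v x"
      unfolding d conj_diag_affine_mult_vec[OF QP PQ] M m_def by (simp add: matrix_vector_mul_assoc)
    also have "\<dots> = a *s ec + b *s g"
      by (simp add: x_def matrix_vector_right_distrib inv)
    finally have eq: "\<alpha> * x $ i + \<beta> * m $ i = a * ec $ i + b * g $ i" for i
      by (simp add: vec_eq_iff)
    have S'n: "?S' *v n = (1 / (of_real tn * s)) *s (m - of_real tb *s g)"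
      by (simp add: n_def m_def g_def matrix_vector_mult_scalar matrix_vector_mult_diff_distrib)
    have "s *s stack x n - complex_matrix (aug_A q tx tn \<rho> S) *v stack x n
        = complex_matrix (aug_B tx tn \<rho> tb tc S) *v stack ec eb"
      unfolding complex_aug_A_mult complex_aug_B_mult scalar_mult_stack diff_stack stack_eq_iff
        S'n m_def[symmetric] g_def[symmetric]
    proof
      have "s * x $ i + (q * x $ i + \<rho> * m $ i + (m $ i - tb * g $ i) / (tn * s)) / tx
          = - tc / tx * ec $ i + \<rho> * tb / tx * g $ i" for i
      proof -
        have "tx * tn * s * (s * x $ i + (q * x $ i + \<rho> * m $ i + (m $ i - tb * g $ i) / (tn * s)) / tx)
            = \<alpha> * x $ i + \<beta> * m $ i - tb * g $ i"
          using pos s by (simp add: \<alpha>_def \<beta>_def field_simps power2_eq_square)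
        also have "\<dots> = tx * tn * s * (- tc / tx * ec $ i + \<rho> * tb / tx * g $ i)"
          unfolding eq using pos by (simp add: a_def b_def field_simps)
        finally show ?thesis using pos s by simp
      qed
      then show "s *s x - - (1 / tx) *\<^sub>R (q *\<^sub>R x + \<rho> *\<^sub>R m + (1 / (of_real tn * s)) *s (m - of_real tb *s g))
          = (- tc / tx) *\<^sub>R ec + (\<rho> * tb / tx) *\<^sub>R g"
        by (simp add: vec_eq_iff scaleR_conv_of_real[where 'a=complex] divide_inverse[of _ "of_real tx"] mult.commute
            diff_divide_distrib)
      show "s *s n - (1 / tn) *\<^sub>R (?S *v x) = (- tb / tn) *\<^sub>R eb"
        using pos s by (simp add: n_def vec_eq_iff scaleR_conv_of_real[where 'a=complex] field_simps)
    qed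
    then have "?G *v u = sqrt q *\<^sub>R x"
      unfolding u
      by (subst transfer_function_mult_vec[OF hurwitz_aug_A[OF assms(1) pos] s(1), of "stack x n"])
        (simp_all add: complex_aug_C_mult)
    moreover have T_scale: "of_real r *s (T c *v z) = T (of_real r * c) *v z" for r c z
    proof -
      have "T (of_real r * c) = ?P ** (diag_matrix (\<lambda>i. of_real r) ** diag_matrix (\<lambda>i. c / ?d i)) ** transpose ?P"
        by (simp add: T_def diag_matrix_mult)
      moreover have "diag_matrix (\<lambda>i. of_real r) *v y = of_real r *s y" for y :: "complex^'x"
        by (simp add: vec_eq_iff diag_matrix_mult_vec)
      ultimately show ?thesis
        by (simp add: T_def matrix_vector_mul_assoc[symmetric] matrix_vector_mult_scalar)
    qed
    moreover have "sqrt q *\<^sub>R x = of_real (sqrt q) *s x"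
      by (simp add: vec_eq_iff scaleR_conv_of_real[where 'a=complex])
    ultimately show ?thesis
      by (simp add: u x_def block_row_mult_stack_semiring T_scale g_def a_def b_def
          matrix_vector_mul_assoc[symmetric] vector_add_ldistrib mult_ac)
  qed
  then show ?thesis
    by (simp add: matrix_eq)
qed

section \<open>The squared norm as a sum over modes\<close>

text \<open>\<open>l i\<close> is the squared norm of column \<open>i\<close> of
  \<open>S ** P\<close>.\<close>

lemma transpose_mult_self_eigenvalue_nonneg:
  fixes S :: "real^'n^'m"
  assumes "orthogonal_matrix P" "transpose S ** S = P ** diag_matrix l ** transpose P"
  shows "l i \<ge> 0"
proof -
  have "transpose (S ** P) ** (S ** P) = transpose P ** (transpose S ** S) ** P"
    by (simp add: matrix_transpose_mul matrix_mul_assoc)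
  also have "\<dots> = (transpose P ** P) ** diag_matrix l ** (transpose P ** P)"
    unfolding assms(2) by (simp add: matrix_mul_assoc)
  also have "\<dots> = diag_matrix l"
    using assms(1) by (simp add: orthogonal_matrix_def)
  finally have "l i = (transpose (S ** P) ** (S ** P)) $ i $ i"
    by (simp add: diag_matrix_def)
  also have "\<dots> = (\<Sum>k\<in>UNIV. ((S ** P) $ k $ i)\<^sup>2)"
    by (subst matrix_matrix_mult_def) (simp add: transpose_def power2_eq_square)
  also have "\<dots> \<ge> 0"
    by (intro sum_nonneg) simp
  finally show ?thesis .
qed

lemma trace_transfer_function_aug:
  fixes S :: "real^'x^'r" and P :: "real^'x^'x" and tb tc :: real
  assumes "rank S = CARD('r)" and pos: "q > 0" "tx > 0" "tn > 0" "\<rho> \<ge> 0"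
    and orth: "orthogonal_matrix P" and SS: "transpose S ** S = P ** diag_matrix l ** transpose P"
    and "w \<noteq> 0"
  defines "G \<equiv> transfer_function (aug_A q tx tn \<rho> S) (aug_B tx tn \<rho> tb tc S)
                 (aug_C q :: real^('x + 'r)^'x)"
  shows "trace (transpose (G (- (\<i> * of_real w))) ** G (\<i> * of_real w)) = of_real
    (\<Sum>i\<in>UNIV. q * tn\<^sup>2 * (tc\<^sup>2 + tb\<^sup>2 * \<rho>\<^sup>2 * l i)
                * (w\<^sup>2 / quadratic_abs_sq (tx * tn) (tn * (q + \<rho> * l i)) (l i) w)
              + q * tb\<^sup>2 * l i * (1 / quadratic_abs_sq (tx * tn) (tn * (q + \<rho> * l i)) (l i) w))"
proof -
  let ?P = "complex_matrix P" and ?S = "complex_matrix S"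
  define s where "s = \<i> * complex_of_real w"
  define d where "d = (\<lambda>i. mode_denom q tx tn \<rho> (l i))"
  define a where "a s = - of_real (sqrt q * tc * tn) * s" for s :: complex
  define b where "b s = of_real (sqrt q * tb) * (of_real (\<rho> * tn) * s + 1)" for s :: complex
  define T where "T c = ?P ** diag_matrix c ** transpose ?P" for c
  have l: "l i \<ge> 0" for i
    using transpose_mult_self_eigenvalue_nonneg[OF orth SS] .
  have PQ: "?P ** transpose ?P = mat 1" and QP: "transpose ?P ** ?P = mat 1"
    using orth by (simp_all add: complex_matrix_hom(1-3)[symmetric] orthogonal_matrix_def)
      (simp_all add: complex_matrix_mat)
  have M: "transpose ?S ** ?S = T (\<lambda>i. of_real (l i))"
    by (simp add: T_def complex_matrix_diag[symmetric] complex_matrix_hom(1-2)[symmetric] SS)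
  have T_mult: "T c ** T e = T (\<lambda>i. c i * e i)" for c e
    unfolding T_def by (rule conj_diag_mult[OF QP PQ])
  have T_trace: "trace (T c) = sum c UNIV" for c
    unfolding T_def by (rule trace_conj_diag[OF QP PQ])
  have T_transpose: "transpose (T c) = T c" for c
    by (simp add: T_def matrix_transpose_mul transpose_diag_matrix matrix_mul_assoc)
  \<comment> \<open>Both \<open>s\<close> and \<open>- s\<close> lie on the imaginary axis, so the
    closed half-plane formula covers the two factors of the trace.\<close>
  have G: "G u = block_row (T (\<lambda>i. a u / d i u)) (T (\<lambda>i. b u / d i u) ** transpose ?S)"
    if "u = s \<or> u = - s" for u
    unfolding G_def T_def d_def a_def b_def
  proof (rule transfer_function_aug[OF assms(1) pos orth SS])
    show "Re u \<ge> 0" "u \<noteq> 0" using that \<open>w \<noteq> 0\<close> by (auto simp: s_def)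
    show "mode_denom q tx tn \<rho> (l i) u \<noteq> 0" for i
      using that mode_denom_nonzero[OF pos(1,3,4) l, of w] mode_denom_nonzero[OF pos(1,3,4) l, of "- w"]
        \<open>w \<noteq> 0\<close> by (auto simp: s_def)
  qed
  have "trace (transpose (G (- s)) ** G s)
      = trace (T (\<lambda>i. a (- s) / d i (- s)) ** T (\<lambda>i. a s / d i s))
        + trace (?S ** (T (\<lambda>i. b (- s) / d i (- s)) ** T (\<lambda>i. b s / d i s) ** transpose ?S))"
    by (simp add: G trace_transpose_block_row matrix_transpose_mul T_transpose matrix_mul_assoc)
  \<comment> \<open>Cyclicity brings the two outer factors together as S^T S, diagonal in the same
    basis; this is the origin of the factor \<open>l i\<close> on the contribution of
    \<open>\<eta>\<^sub>b\<close>.\<close>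
  also have "trace (?S ** (T (\<lambda>i. b (- s) / d i (- s)) ** T (\<lambda>i. b s / d i s) ** transpose ?S))
      = trace (T (\<lambda>i. b (- s) / d i (- s)) ** T (\<lambda>i. b s / d i s) ** (transpose ?S ** ?S))"
    by (subst trace_mul_sym) (simp add: matrix_mul_assoc)
  also have "trace (T (\<lambda>i. a (- s) / d i (- s)) ** T (\<lambda>i. a s / d i s)) + \<dots>
      = (\<Sum>i\<in>UNIV. (a (- s) * a s + b (- s) * b s * of_real (l i)) / (d i (- s) * d i s))"
    unfolding M T_mult T_trace sum.distrib[symmetric]
    by (intro sum.cong) (simp_all add: add_divide_distrib)
  also have "\<dots> = (\<Sum>i\<in>UNIV. of_real (q * tn\<^sup>2 * (tc\<^sup>2 + tb\<^sup>2 * \<rho>\<^sup>2 * l i)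
                * (w\<^sup>2 / quadratic_abs_sq (tx * tn) (tn * (q + \<rho> * l i)) (l i) w)
              + q * tb\<^sup>2 * l i * (1 / quadratic_abs_sq (tx * tn) (tn * (q + \<rho> * l i)) (l i) w)))"
  proof (intro sum.cong refl)
    fix i :: 'x
    have sq: "complex_of_real (sqrt q) * complex_of_real (sqrt q) = of_real q"
      using pos by (simp flip: of_real_mult)
    have "a (- s) * a s = of_real (sqrt q) * of_real (sqrt q) * of_real (tc\<^sup>2 * tn\<^sup>2 * w\<^sup>2)"
      by (simp add: a_def s_def power2_eq_square algebra_simps)
    \<comment> \<open>The terms linear in \<open>s\<close> cancel. The constant 1 leads to the term
      with \<open>tb\<^sup>2 / (2 * tn)\<close>, the part with \<rho> to the last sum of the
      theorem.\<close>
    moreover have "b (- s) * b s = of_real (sqrt q) * of_real (sqrt q) * of_real (tb\<^sup>2 * (\<rho>\<^sup>2 * tn\<^sup>2 * w\<^sup>2 + 1))"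
      by (simp add: b_def s_def power2_eq_square algebra_simps)
    ultimately have "a (- s) * a s + b (- s) * b s * of_real (l i)
        = of_real (q * tn\<^sup>2 * (tc\<^sup>2 + tb\<^sup>2 * \<rho>\<^sup>2 * l i) * w\<^sup>2 + q * tb\<^sup>2 * l i)"
      unfolding sq by (simp add: algebra_simps)
    then show "(a (- s) * a s + b (- s) * b s * of_real (l i)) / (d i (- s) * d i s)
      = of_real (q * tn\<^sup>2 * (tc\<^sup>2 + tb\<^sup>2 * \<rho>\<^sup>2 * l i)
                * (w\<^sup>2 / quadratic_abs_sq (tx * tn) (tn * (q + \<rho> * l i)) (l i) w)
              + q * tb\<^sup>2 * l i * (1 / quadratic_abs_sq (tx * tn) (tn * (q + \<rho> * l i)) (l i) w))"
      by (simp add: d_def s_def mode_denom_conjugate add_divide_distrib)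
  qed
  finally show ?thesis
    by (simp add: s_def)
qed

text \<open>At \<open>l = 0\<close> the disturbance \<open>\<eta>\<^sub>b\<close> does not reach the mode, so its contribution does not
  arise as the limit \<open>l \<rightarrow> 0\<close> of the generic one.\<close>

definition mode_h2_sq :: "real \<Rightarrow> real \<Rightarrow> real \<Rightarrow> real \<Rightarrow> real \<Rightarrow> real \<Rightarrow> real \<Rightarrow> real" where
  "mode_h2_sq q tx tn \<rho> tb tc l =
     tc\<^sup>2 / (2 * tx) * (q / (q + \<rho> * l)) + tb\<^sup>2 / (2 * tx) * (q * \<rho>\<^sup>2 * l / (q + \<rho> * l))
     + (if l = 0 then 0 else tb\<^sup>2 / (2 * tn) * (q / (q + \<rho> * l)))"

text \<open>The factor \<open>2 * pi\<close> is the one that the normalization of the norm removes.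
  For \<open>l > 0\<close> the input factor \<open>l\<close> cancels against the same factor in the
  denominator of the second integral.\<close>

lemma has_bochner_integral_mode:
  assumes pos: "q > 0" "tx > 0" "tn > 0" "\<rho> \<ge> 0" "l \<ge> 0"
  defines "D \<equiv> quadratic_abs_sq (tx * tn) (tn * (q + \<rho> * l)) l"
  shows "has_bochner_integral lborel
    (\<lambda>w. q * tn\<^sup>2 * (tc\<^sup>2 + tb\<^sup>2 * \<rho>\<^sup>2 * l) * (w\<^sup>2 / D w) + q * tb\<^sup>2 * l * (1 / D w))
    (2 * pi * mode_h2_sq q tx tn \<rho> tb tc l)"
proof -
  have a: "q + \<rho> * l > 0"
    using pos by (simp add: add_pos_nonneg)
  have b: "tx * tn > 0" "tn * (q + \<rho> * l) > 0"
    using pos a by auto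
  show ?thesis
  proof (cases "l = 0")
    case True
    have "has_bochner_integral lborel (\<lambda>w. q * tn\<^sup>2 * tc\<^sup>2 * (w\<^sup>2 / D w))
        (q * tn\<^sup>2 * tc\<^sup>2 * (pi / (tn * q * (tx * tn))))"
      using has_bochner_integral_quadratic_abs_sq_degenerate[OF b] True
      by (intro has_bochner_integral_mult_right) (auto simp: D_def)
    also have "q * tn\<^sup>2 * tc\<^sup>2 * (pi / (tn * q * (tx * tn))) = 2 * pi * mode_h2_sq q tx tn \<rho> tb tc l"
      using pos True by (simp add: mode_h2_sq_def field_simps power2_eq_square)
    finally show ?thesis
      by (simp add: True)
  next
    case False
    then have "l > 0" using pos by simp
    have "has_bochner_integral lborel
        (\<lambda>w. q * tn\<^sup>2 * (tc\<^sup>2 + tb\<^sup>2 * \<rho>\<^sup>2 * l) * (w\<^sup>2 / D w) + q * tb\<^sup>2 * l * (1 / D w))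
        (q * tn\<^sup>2 * (tc\<^sup>2 + tb\<^sup>2 * \<rho>\<^sup>2 * l) * (pi / (tn * (q + \<rho> * l) * (tx * tn)))
         + q * tb\<^sup>2 * l * (pi / (tn * (q + \<rho> * l) * l)))"
      unfolding D_def
      using has_bochner_integral_quadratic_abs_sq[OF b \<open>l > 0\<close>]
      by (intro has_bochner_integral_add has_bochner_integral_mult_right)
    also have "q * tn\<^sup>2 * (tc\<^sup>2 + tb\<^sup>2 * \<rho>\<^sup>2 * l) * (pi / (tn * (q + \<rho> * l) * (tx * tn)))
         + q * tb\<^sup>2 * l * (pi / (tn * (q + \<rho> * l) * l)) = 2 * pi * mode_h2_sq q tx tn \<rho> tb tc l"
    proof -
      define c where "c = q + \<rho> * l"
      have "c > 0" using a by (simp add: c_def)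
      then show ?thesis
        unfolding mode_h2_sq_def c_def[symmetric]
        using pos \<open>l > 0\<close> by (simp add: field_simps power2_eq_square)
    qed
    finally show ?thesis .
  qed
qed

lemma h2_norm_sq_aug:
  fixes S :: "real^'x^'r" and P :: "real^'x^'x"
  assumes "rank S = CARD('r)" and pos: "q > 0" "tx > 0" "tn > 0" "\<rho> \<ge> 0"
    and orth: "orthogonal_matrix P" and SS: "transpose S ** S = P ** diag_matrix l ** transpose P"
  shows "(h2_norm (aug_A q tx tn \<rho> S) (aug_B tx tn \<rho> tb tc S) (aug_C q :: real^('x + 'r)^'x))\<^sup>2
    = (\<Sum>i\<in>UNIV. mode_h2_sq q tx tn \<rho> tb tc (l i))" (is "_ = ?H")
proof -
  let ?G = "transfer_function (aug_A q tx tn \<rho> S) (aug_B tx tn \<rho> tb tc S) (aug_C q :: real^('x + 'r)^'x)"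
  have l: "l i \<ge> 0" for i
    using transpose_mult_self_eigenvalue_nonneg[OF orth SS] .
  have "has_bochner_integral lborel (\<lambda>w. complex_of_real
      (\<Sum>i\<in>UNIV. q * tn\<^sup>2 * (tc\<^sup>2 + tb\<^sup>2 * \<rho>\<^sup>2 * l i)
                * (w\<^sup>2 / quadratic_abs_sq (tx * tn) (tn * (q + \<rho> * l i)) (l i) w)
              + q * tb\<^sup>2 * l i * (1 / quadratic_abs_sq (tx * tn) (tn * (q + \<rho> * l i)) (l i) w)))
      (of_real (\<Sum>i\<in>UNIV. 2 * pi * mode_h2_sq q tx tn \<rho> tb tc (l i)))"
    by (intro has_bochner_integral_of_real has_bochner_integral_sum has_bochner_integral_mode pos l)
  \<comment> \<open>The modal sum replaces the true trace everywhere except at \<open>w = 0\<close>,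
    where eliminating nu is not possible.\<close>
  then have "has_bochner_integral lborel
      (\<lambda>w. trace (transpose (?G (- (\<i> * of_real w))) ** ?G (\<i> * of_real w))) (of_real (2 * pi * ?H))"
    unfolding sum_distrib_left
    by (rule has_bochner_integral_lborel_cong_off_point[where c = 0])
      (rule trace_transfer_function_aug[OF assms])
  then have "(LINT w|lborel. trace (transpose (?G (- (\<i> * of_real w))) ** ?G (\<i> * of_real w)))
      = of_real (2 * pi * ?H)"
    by (rule has_bochner_integral_integral_eq)
  then have "h2_norm (aug_A q tx tn \<rho> S) (aug_B tx tn \<rho> tb tc S) (aug_C q :: real^('x + 'r)^'x) = sqrt ?H"
    by (simp add: h2_norm_def)
  moreover have "?H \<ge> 0"
    unfolding mode_h2_sq_def using pos l by (intro sum_nonneg add_nonneg_nonneg) auto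
  ultimately show ?thesis by simp
qed

theorem mainTheorem3:
  fixes S :: "real^'x^'r"
    and q tx tn \<rho> tb tc :: real
    and \<sigma> :: "nat \<Rightarrow> real"
  assumes "CARD('r) < CARD('x)"
    and "rank S = CARD('r)"
    and "q > 0" "tx > 0" "tn > 0"
    and "\<rho> \<ge> 0" "tb \<ge> 0" "tc \<ge> 0"
    and "image_mset \<sigma> (mset_set {1..CARD('r)}) = filter_mset (\<lambda>s. s \<noteq> 0) (singular_values S)"
  shows "hurwitz (aug_A q tx tn \<rho> S) \<and>
    (h2_norm (aug_A q tx tn \<rho> S) (aug_B tx tn \<rho> tb tc S) (aug_C q :: real^('x + 'r)^'x))\<^sup>2
      = tc\<^sup>2 / (2 * tx) * (real CARD('x) - real CARD('r))
        + (tb\<^sup>2 / (2 * tn) + tc\<^sup>2 / (2 * tx)) * (\<Sum>i = 1..CARD('r). q / (q + \<rho> * (\<sigma> i)\<^sup>2))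
        + tb\<^sup>2 / (2 * tx) * (\<Sum>i = 1..CARD('r). q * \<rho>\<^sup>2 * (\<sigma> i)\<^sup>2 / (q + \<rho> * (\<sigma> i)\<^sup>2))"
proof
  show "hurwitz (aug_A q tx tn \<rho> S)"
    using assms by (intro hurwitz_aug_A) auto
next
  have "transpose (transpose S ** S) = transpose S ** S"
    by (simp add: matrix_transpose_mul)
  then obtain P l where orth: "orthogonal_matrix P"
      and SS: "transpose S ** S = P ** diag_matrix l ** transpose P"
    by (rule symmetric_matrix_diagonalization)
  have l: "l i \<ge> 0" for i
    using transpose_mult_self_eigenvalue_nonneg[OF orth SS] .
  \<comment> \<open>The contribution of a mode as a function of its singular value; as
    \<open>l i\<close> is nonnegative, \<open>h (sqrt (l i))\<close> is the contribution of mode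
    \<open>i\<close>.\<close>
  define h where "h = (\<lambda>s. mode_h2_sq q tx tn \<rho> tb tc (s\<^sup>2))"
  define Z where "Z = filter_mset (\<lambda>s. \<not> s \<noteq> 0) (singular_values S)"
  define N where "N = image_mset \<sigma> (mset_set {1..CARD('r)})"
  have sv: "singular_values S = image_mset (\<lambda>i. sqrt (l i)) (mset_set UNIV)"
    by (rule singular_values_diagonalization[OF orth SS])
  have split: "singular_values S = N + Z"
    unfolding N_def assms(9) Z_def by (rule multiset_partition)
  have "size (singular_values S) = CARD('x)"
    by (simp add: sv)
  \<comment> \<open>The multiplicity of the singular value 0 is obtained by counting: there are
    \<open>CARD('x)\<close> values in all, and \<sigma> lists \<open>CARD('r)\<close> non-zero
    ones.\<close>
  then have size_Z: "real (size Z) = real CARD('x) - real CARD('r)"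
    by (simp add: split N_def)
  have "Z = replicate_mset (size Z) 0"
    by (simp add: Z_def filter_eq_replicate_mset)
  then have "(\<Sum>s\<in>#Z. h s) = real (size Z) * h 0"
    by (metis image_replicate_mset sum_mset_replicate_mset)
  also have "h 0 = tc\<^sup>2 / (2 * tx)"
    using assms by (simp add: h_def mode_h2_sq_def)
  finally have sum_Z: "(\<Sum>s\<in>#Z. h s) = tc\<^sup>2 / (2 * tx) * (real CARD('x) - real CARD('r))"
    by (simp add: size_Z)
  have nz: "\<sigma> i \<noteq> 0" if "i \<in> {1..CARD('r)}" for i
  proof -
    have "\<sigma> i \<in># filter_mset (\<lambda>s. s \<noteq> 0) (singular_values S)"
      unfolding assms(9)[symmetric] using that by simp
    then show ?thesis by simp
  qed
  have "(\<Sum>s\<in>#N. h s) = (\<Sum>i = 1..CARD('r). h (\<sigma> i))"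
    by (simp add: N_def image_mset.compositionality o_def sum_unfold_sum_mset)
  also have "\<dots> = (\<Sum>i = 1..CARD('r). (tb\<^sup>2 / (2 * tn) + tc\<^sup>2 / (2 * tx)) * (q / (q + \<rho> * (\<sigma> i)\<^sup>2))
      + tb\<^sup>2 / (2 * tx) * (q * \<rho>\<^sup>2 * (\<sigma> i)\<^sup>2 / (q + \<rho> * (\<sigma> i)\<^sup>2)))"
    using nz by (intro sum.cong refl) (simp add: h_def mode_h2_sq_def distrib_right add_divide_distrib)
  finally have sum_N: "(\<Sum>s\<in>#N. h s)
      = (tb\<^sup>2 / (2 * tn) + tc\<^sup>2 / (2 * tx)) * (\<Sum>i = 1..CARD('r). q / (q + \<rho> * (\<sigma> i)\<^sup>2))
        + tb\<^sup>2 / (2 * tx) * (\<Sum>i = 1..CARD('r). q * \<rho>\<^sup>2 * (\<sigma> i)\<^sup>2 / (q + \<rho> * (\<sigma> i)\<^sup>2))"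
    by (simp add: sum.distrib sum_distrib_left)
  have "(h2_norm (aug_A q tx tn \<rho> S) (aug_B tx tn \<rho> tb tc S) (aug_C q :: real^('x + 'r)^'x))\<^sup>2
      = (\<Sum>i\<in>UNIV. h (sqrt (l i)))"
    using h2_norm_sq_aug[OF assms(2-6) orth SS] l by (simp add: h_def)
  also have "\<dots> = (\<Sum>s\<in>#singular_values S. h s)"
    by (simp add: sv image_mset.compositionality o_def sum_unfold_sum_mset)
  also have "\<dots> = (\<Sum>s\<in>#Z. h s) + (\<Sum>s\<in>#N. h s)"
    by (simp add: split)
  finally show "(h2_norm (aug_A q tx tn \<rho> S) (aug_B tx tn \<rho> tb tc S) (aug_C q :: real^('x + 'r)^'x))\<^sup>2
      = tc\<^sup>2 / (2 * tx) * (real CARD('x) - real CARD('r))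
        + (tb\<^sup>2 / (2 * tn) + tc\<^sup>2 / (2 * tx)) * (\<Sum>i = 1..CARD('r). q / (q + \<rho> * (\<sigma> i)\<^sup>2))
        + tb\<^sup>2 / (2 * tx) * (\<Sum>i = 1..CARD('r). q * \<rho>\<^sup>2 * (\<sigma> i)\<^sup>2 / (q + \<rho> * (\<sigma> i)\<^sup>2))"
    by (simp add: sum_Z sum_N)
qed

end
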